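(* Let $P$ be a finite poset, $\ell,q$ positive integers, $u,v$ as in the context, and assume the restriction function $R^q$ is defined. For every $f\in\mathcal L_{P\times[\ell]}(u,v,R^q)$, $\mathrm{JdtPro}(f)=\mathrm{Pro}(f)$.
   Context: $P\times[\ell]=\{(p,i):p\in P,1\le i\le\ell\}$; $u,v:P\to\{0,\ldots,\ell\}$ satisfy $u(p)+v(p)\le\ell$ and $v(p_1)\le v(p_2)$, $u(p_1)\ge u(p_2)$ when $p_1\le_Pp_2$; $P\times[\ell]^v_u=\{(p,i):u(p)<i<\ell+1-v(p)\}$, fibers $F_p=\{(p,i)\in P\times[\ell]^v_u\}$. For a map $R$ from $P$ to nonempty finite subsets of $\mathbb Z$, $\mathcal L_{P\times[\ell]}(u,v,R)$ is the set of $f:P\times[\ell]^v_u\to\mathbb Z$ with $f(p_1,i)<f(p_2,i)$ for $p_1<_Pp_2$, $f(p,i_1)\le f(p,i_2)$ for $i_1\le i_2$, $f(p,i)\in R(p)$. $R^q(p)$ is the set of $k\in\{1,\ldots,q\}$ attained as $f(p,i)$ by some $f\in\mathcal L_{P\times[\ell]}(u,v,p\mapsto\{1,\ldots,q\})$ (assumed nonempty). With $R=R^q$: $R(p)_{>k}$ is the smallest element of $R(p)$ greater than $k$; $f(p,i)$ is raisable (lowerable) if some $g\in\mathcal L_{P\times[\ell]}(u,v,R)$ has $g(p,i)>f(p,i)$ (resp. $<$) and $g(p',i')=f(p',i')$ whenever $p'\ne p$. Bender–Knuth $\rho_k$: in each fiber $F_p$ with $k\in R(p)$, $k\ne\max R(p)$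 (others unchanged), the free labels are raisable labels equal to $k$ and lowerable labels equal to $R(p)_{>k}$; if they read $a$ copies of $k$ then $b$ copies of $R(p)_{>k}$, replace by $b$ copies of $k$ then $a$ copies of $R(p)_{>k}$. $\mathrm{Pro}=\cdots\circ\rho_2\circ\rho_1\circ\rho_0\circ\rho_{-1}\circ\cdots$. Jeu de taquin: for $g:P\times[\ell]^v_u\to\mathbb Z\cup\{\square\}$, $\mathrm{jdt}_i(g)(p,k)$ (all referenced elements in $P\times[\ell]^v_u$) equals: $i$ if $g(p,k)=\square$ and $g(p',k)=i$ for some $p'\gtrdot_Pp$; $i$ if $g(p,k)=\square$, $g(p,k+1)=i$ and $g(p',k+1)\ne\square$ for every $p'\lessdot_Pp$; $\square$ if $g(p,k)=i$ and $g(p',k)=\square$ for some $p'\lessdot_Pp$; $\square$ if $g(p,k)=i$, $g(p,k-1)=\square$ and $g(p',k-1)\ne i$ for every $p'\gtrdot_Pp$; $g(p,k)$ otherwise. $\mathrm{jdt}_{i\to j}$ replaces all labels $i$ by $j$. $\mathrm{jdt}(f)=\mathrm{jdt}_{\square\to q+1}\circ(\mathrm{jdt}_q)^\ell\circ\cdots\circ(\mathrm{jdt}_2)^\ell\circ\mathrm{jdt}_{1\to\square}(f)$ and $\mathrm{JdtPro}(f)(x)=\mathrm{jdt}(f)(x)-1$. *)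

theory Defs
  imports Main "HOL-Library.FuncSet"
begin

text \<open>
  A finite poset is a finite subset \<open>P\<close> of a type of class \<open>order\<close>, with the induced order.
  Functions on \<open>P \<times> [\<ell>]\<^sup>v\<^sub>u\<close> are rendered as extensional functions on \<open>P_dom P l u v\<close>, so that
  equality of HOL functions is equality of functions on that domain.
\<close>

definition covers_in :: "'a::order set \<Rightarrow> 'a \<Rightarrow> 'a \<Rightarrow> bool" where
  "covers_in P p p' \<longleftrightarrow> p \<in> P \<and> p' \<in> P \<and> p < p' \<and> \<not> (\<exists>z\<in>P. p < z \<and> z < p')"

definition P_dom :: "'a set \<Rightarrow> nat \<Rightarrow> ('a \<Rightarrow> nat) \<Rightarrow> ('a \<Rightarrow> nat) \<Rightarrow> ('a \<times> nat) set" where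
  "P_dom P l u v = {(p, i). p \<in> P \<and> i \<in> {1..l} \<and> u p < i \<and> i < l + 1 - v p}"

definition P_strict :: "'a::order set \<Rightarrow> nat \<Rightarrow> ('a \<Rightarrow> nat) \<Rightarrow> ('a \<Rightarrow> nat) \<Rightarrow> ('a \<Rightarrow> int set)
    \<Rightarrow> ('a \<times> nat \<Rightarrow> int) set" where
  "P_strict P l u v R = {f \<in> extensional (P_dom P l u v).
     (\<forall>p1 p2 i. (p1, i) \<in> P_dom P l u v \<longrightarrow> (p2, i) \<in> P_dom P l u v \<longrightarrow> p1 < p2
        \<longrightarrow> f (p1, i) < f (p2, i)) \<and>
     (\<forall>p i1 i2. (p, i1) \<in> P_dom P l u v \<longrightarrow> (p, i2) \<in> P_dom P l u v \<longrightarrow> i1 \<le> i2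
        \<longrightarrow> f (p, i1) \<le> f (p, i2)) \<and>
     (\<forall>p i. (p, i) \<in> P_dom P l u v \<longrightarrow> f (p, i) \<in> R p)}"

definition Rq :: "'a::order set \<Rightarrow> nat \<Rightarrow> ('a \<Rightarrow> nat) \<Rightarrow> ('a \<Rightarrow> nat) \<Rightarrow> int \<Rightarrow> 'a \<Rightarrow> int set" where
  "Rq P l u v q p = {k \<in> {1..q}. \<exists>f \<in> P_strict P l u v (\<lambda>_. {1..q}).
     \<exists>i. (p, i) \<in> P_dom P l u v \<and> f (p, i) = k}"

definition R_next :: "('a \<Rightarrow> int set) \<Rightarrow> 'a \<Rightarrow> int \<Rightarrow> int" where
  "R_next R p k = Min {m \<in> R p. k < m}"

definition raisable :: "'a::order set \<Rightarrow> nat \<Rightarrow> ('a \<Rightarrow> nat) \<Rightarrow> ('a \<Rightarrow> nat) \<Rightarrow> ('a \<Rightarrow> int set)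
    \<Rightarrow> ('a \<times> nat \<Rightarrow> int) \<Rightarrow> 'a \<Rightarrow> nat \<Rightarrow> bool" where
  "raisable P l u v R f p i \<longleftrightarrow> (\<exists>g \<in> P_strict P l u v R. f (p, i) < g (p, i) \<and>
     (\<forall>p' i'. (p', i') \<in> P_dom P l u v \<longrightarrow> p' \<noteq> p \<longrightarrow> g (p', i') = f (p', i')))"

definition lowerable :: "'a::order set \<Rightarrow> nat \<Rightarrow> ('a \<Rightarrow> nat) \<Rightarrow> ('a \<Rightarrow> nat) \<Rightarrow> ('a \<Rightarrow> int set)
    \<Rightarrow> ('a \<times> nat \<Rightarrow> int) \<Rightarrow> 'a \<Rightarrow> nat \<Rightarrow> bool" where
  "lowerable P l u v R f p i \<longleftrightarrow> (\<exists>g \<in> P_strict P l u v R. g (p, i) < f (p, i) \<and>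
     (\<forall>p' i'. (p', i') \<in> P_dom P l u v \<longrightarrow> p' \<noteq> p \<longrightarrow> g (p', i') = f (p', i')))"

definition free_pos :: "'a::order set \<Rightarrow> nat \<Rightarrow> ('a \<Rightarrow> nat) \<Rightarrow> ('a \<Rightarrow> nat) \<Rightarrow> ('a \<Rightarrow> int set)
    \<Rightarrow> int \<Rightarrow> ('a \<times> nat \<Rightarrow> int) \<Rightarrow> 'a \<Rightarrow> nat set" where
  "free_pos P l u v R k f p = {i. (p, i) \<in> P_dom P l u v \<and>
     (f (p, i) = k \<and> raisable P l u v R f p i \<or>
      f (p, i) = R_next R p k \<and> lowerable P l u v R f p i)}"

text \<open>
  With \<open>b\<close> free labels equal to \<open>R(p)\<^sub>>\<^sub>k\<close> in the fiber of \<open>p\<close>, the first \<open>b\<close> free positions receive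
  \<open>k\<close> and the remaining ones receive \<open>R(p)\<^sub>>\<^sub>k\<close>.
\<close>

definition bender_knuth :: "'a::order set \<Rightarrow> nat \<Rightarrow> ('a \<Rightarrow> nat) \<Rightarrow> ('a \<Rightarrow> nat) \<Rightarrow> ('a \<Rightarrow> int set)
    \<Rightarrow> int \<Rightarrow> ('a \<times> nat \<Rightarrow> int) \<Rightarrow> ('a \<times> nat \<Rightarrow> int)" where
  "bender_knuth P l u v R k f = (\<lambda>(p, i) \<in> P_dom P l u v.
     let F = free_pos P l u v R k f p; b = card {j \<in> F. f (p, j) = R_next R p k} in
     if k \<in> R p \<and> k \<noteq> Max (R p) \<and> i \<in> F
     then (if card {j \<in> F. j < i} < b then k else R_next R p k)
     else f (p, i))"

text \<open>
  The bi-infinite composition \<open>\<cdots> \<circ> \<rho>\<^sub>2 \<circ> \<rho>\<^sub>1 \<circ> \<rho>\<^sub>0 \<circ> \<cdots>\<close> is the common value of all sufficiently long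
  finite compositions \<open>\<rho>\<^sub>b \<circ> \<cdots> \<circ> \<rho>\<^sub>a\<close>; all but finitely many factors fix every labeling.
\<close>

definition Pro :: "'a::order set \<Rightarrow> nat \<Rightarrow> ('a \<Rightarrow> nat) \<Rightarrow> ('a \<Rightarrow> nat) \<Rightarrow> ('a \<Rightarrow> int set)
    \<Rightarrow> ('a \<times> nat \<Rightarrow> int) \<Rightarrow> ('a \<times> nat \<Rightarrow> int)" where
  "Pro P l u v R f = (THE g. \<exists>N. \<forall>a b. a \<le> - N \<longrightarrow> N \<le> b \<longrightarrow>
     fold (bender_knuth P l u v R) [a..b] f = g)"

text \<open>In jeu de taquin, \<open>None\<close> is the empty box and \<open>Some i\<close> is the integer label \<open>i\<close>.\<close>

definition jdt_step :: "'a::order set \<Rightarrow> nat \<Rightarrow> ('a \<Rightarrow> nat) \<Rightarrow> ('a \<Rightarrow> nat)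
    \<Rightarrow> int \<Rightarrow> ('a \<times> nat \<Rightarrow> int option) \<Rightarrow> ('a \<times> nat \<Rightarrow> int option)" where
  "jdt_step P l u v i g = (\<lambda>(p, k) \<in> P_dom P l u v.
     if g (p, k) = None \<and>
        (\<exists>p'. covers_in P p p' \<and> (p', k) \<in> P_dom P l u v \<and> g (p', k) = Some i)
     then Some i
     else if g (p, k) = None \<and> (p, k + 1) \<in> P_dom P l u v \<and> g (p, k + 1) = Some i \<and>
        (\<forall>p'. covers_in P p' p \<longrightarrow> (p', k + 1) \<in> P_dom P l u v \<longrightarrow> g (p', k + 1) \<noteq> None)
     then Some i
     else if g (p, k) = Some i \<and>
        (\<exists>p'. covers_in P p' p \<and> (p', k) \<in> P_dom P l u v \<and> g (p', k) = None)
     then None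
     else if g (p, k) = Some i \<and> (p, k - 1) \<in> P_dom P l u v \<and> g (p, k - 1) = None \<and>
        (\<forall>p'. covers_in P p p' \<longrightarrow> (p', k - 1) \<in> P_dom P l u v \<longrightarrow> g (p', k - 1) \<noteq> Some i)
     then None
     else g (p, k))"

definition jdt_replace :: "'a set \<Rightarrow> nat \<Rightarrow> ('a \<Rightarrow> nat) \<Rightarrow> ('a \<Rightarrow> nat)
    \<Rightarrow> int option \<Rightarrow> int option \<Rightarrow> ('a \<times> nat \<Rightarrow> int option) \<Rightarrow> ('a \<times> nat \<Rightarrow> int option)" where
  "jdt_replace P l u v x y g = (\<lambda>z \<in> P_dom P l u v. if g z = x then y else g z)"

definition jdt :: "'a::order set \<Rightarrow> nat \<Rightarrow> ('a \<Rightarrow> nat) \<Rightarrow> ('a \<Rightarrow> nat) \<Rightarrow> int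
    \<Rightarrow> ('a \<times> nat \<Rightarrow> int) \<Rightarrow> ('a \<times> nat \<Rightarrow> int option)" where
  "jdt P l u v q f =
     jdt_replace P l u v None (Some (q + 1))
       (fold (\<lambda>i. jdt_step P l u v i ^^ l) [2..q]
         (jdt_replace P l u v (Some 1) None (\<lambda>z. Some (f z))))"

definition JdtPro :: "'a::order set \<Rightarrow> nat \<Rightarrow> ('a \<Rightarrow> nat) \<Rightarrow> ('a \<Rightarrow> nat) \<Rightarrow> int
    \<Rightarrow> ('a \<times> nat \<Rightarrow> int) \<Rightarrow> ('a \<times> nat \<Rightarrow> int)" where
  "JdtPro P l u v q f = (\<lambda>z \<in> P_dom P l u v. the (jdt P l u v q f z) - 1)"

end

theory Submission
  imports Defs
begin

text \<open>
  Both sides are products of operators indexed by the labels, and they are matched factor by factor: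
  after jeu de taquin has treated the labels up to \<open>a\<close>, the boxes are the labels \<open>a\<close> of
  \<open>\<rho>\<^sub>a\<^sub>-\<^sub>1 \<circ> \<cdots> \<circ> \<rho>\<^sub>1\<close>, and all smaller labels are shifted by one.
  In a fiber, the labels \<open>a\<close> and \<open>a + 1\<close> form a block: first the labels \<open>a\<close> lying below an
  \<open>a + 1\<close>, then the free labels, then the labels \<open>a + 1\<close> lying above an \<open>a\<close>. The first step
  of \<open>jdt\<^sub>a\<^sub>+\<^sub>1\<close> exchanges the two vertically blocked groups, which never move again. On the
  free part every step exchanges simultaneously all pairs of a box followed by a label, and this
  sorts a row of length \<open>N\<close> in at most \<open>N\<close> steps, which is what \<open>\<rho>\<^sub>a\<close> does at once.
\<close>

section \<open>Parallel sliding in a row\<close>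

text \<open>True marks a label \<open>a + 1\<close>, False a box. At \<open>j = 0\<close> the
  truncated \<open>j - 1\<close> is \<open>j\<close> itself, and the box condition then fails, so no
  false left neighbour arises.\<close>

definition slide :: "nat set \<Rightarrow> (nat \<Rightarrow> bool) \<Rightarrow> nat \<Rightarrow> bool" where
  "slide F w j = (if w j then \<not> (j - 1 \<in> F \<and> \<not> w (j - 1)) else j + 1 \<in> F \<and> w (j + 1))"

text \<open>The height function of the row: its increments recover \<open>w\<close>, so sortedness
  can be read off from it.\<close>

definition count_below :: "nat \<Rightarrow> (nat \<Rightarrow> bool) \<Rightarrow> nat \<Rightarrow> nat" where
  "count_below s w x = card {j \<in> {s..<s + x}. w j}"

lemma count_below_0 [simp]: "count_below s w 0 = 0"
  by (simp add: count_below_def)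

lemma count_below_Suc [simp]:
  "count_below s w (Suc x) = count_below s w x + of_bool (w (s + x))"
proof -
  have "{j \<in> {s..<s + Suc x}. w j} =
      {j \<in> {s..<s + x}. w j} \<union> (if w (s + x) then {s + x} else {})"
    by (auto simp: less_Suc_eq)
  then show ?thesis
    by (auto simp: count_below_def)
qed

lemma count_below_le: "count_below s w x \<le> x"
  by (induction x) auto

lemma count_below_mono: "x \<le> y \<Longrightarrow> count_below s w x \<le> count_below s w y"
  by (induction y rule: dec_induct) auto

lemma count_below_lipschitz:
  "x \<le> y \<Longrightarrow> count_below s w y \<le> count_below s w x + (y - x)"
  by (induction y rule: dec_induct) auto

text \<open>A swap on one side of the cut at \<open>x\<close> does not change the count; only a swap
  across the cut does, and it brings one label into the prefix.\<close>

lemma count_below_slide: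
  assumes "x \<le> N"
  shows "count_below s (slide {s..<s + N} w) x =
    count_below s w x + of_bool (0 < x \<and> x < N \<and> \<not> w (s + x - 1) \<and> w (s + x))"
  using assms
proof (induction x)
  case (Suc x)
  have "slide {s..<s + N} w (s + x) =
      (if w (s + x) then \<not> (0 < x \<and> \<not> w (s + x - 1)) else x + 1 < N \<and> w (s + x + 1))"
    using Suc.prems by (cases x; cases s) (auto simp: slide_def)
  then show ?case
    using Suc by (auto simp: of_bool_def)
qed auto

text \<open>The height function satisfies \<open>c' x = min (c (x - 1) + 1) (c (x + 1))\<close>, and the bound
  below is a subsolution of this recursion.\<close>

lemma count_below_slide_pow_ge:
  fixes s N t x :: nat and w :: "nat \<Rightarrow> bool"
  defines "c \<equiv> \<lambda>t x. int (count_below s ((slide {s..<s + N} ^^ t) w) x)"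
  assumes "x \<le> N"
  shows "c t N = c 0 N \<and>
    min (2 * int x) (min (2 * c 0 N) (int x - (int N - c 0 N) + int t)) \<le> 2 * c t x"
  using \<open>x \<le> N\<close>
proof (induction t arbitrary: x)
  case 0
  \<comment> \<open>At most \<open>N - x\<close> labels lie at or after \<open>x\<close>; this
    bounds the third term of the minimum by \<open>c 0 x\<close>.\<close>
  have "c 0 N \<le> c 0 x + (int N - int x)"
    using count_below_lipschitz[OF 0, of s w] 0 by (simp add: c_def)
  then show ?case
    by (simp add: c_def min_le_iff_disj)
next
  case (Suc t)
  have total: "c (Suc t) N = c 0 N"
    using Suc.IH[of N] by (simp add: c_def count_below_slide)
  consider "x = 0" | "x = N" | "0 < x" "x < N"
    using Suc.prems by linarith
  then have "min (2 * int x) (min (2 * c 0 N) (int x - (int N - c 0 N) + int (Suc t))) \<le> 2 * c (Suc t) x"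
  proof cases
    case 1
    then show ?thesis by (simp add: c_def)
  next
    case 2
    then show ?thesis using total by simp
  next
    case 3
    define w' where "w' = (slide {s..<s + N} ^^ t) w"
    obtain y where y: "x = Suc y"
      using 3 by (cases x) auto
    have ct: "c t z = int (count_below s w' z)" for z
      by (simp add: c_def w'_def)
    have "c (Suc t) x = c t x + of_bool (\<not> w' (s + y) \<and> w' (s + x))"
    proof -
      have "c (Suc t) x = int (count_below s (slide {s..<s + N} w') x)"
        by (simp add: c_def w'_def)
      then show ?thesis
        using 3 by (simp add: count_below_slide ct y del: count_below_Suc)
    qed
    moreover have "c t (Suc x) = c t x + of_bool (w' (s + x))"
      by (simp add: ct)
    moreover have "c t x = c t y + of_bool (w' (s + y))"
      by (simp add: ct y)
    ultimately have "c (Suc t) x \<ge> min (c t y + 1) (c t (Suc x))"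
      by (auto simp: of_bool_def)
    \<comment> \<open>Going from \<open>(Suc t, x)\<close> to \<open>(t, x - 1)\<close> lowers each
      term of the bound by at most 2, which the doubled \<open>+ 1\<close> of the recursion repays;
      going to \<open>(t, Suc x)\<close> lowers none.\<close>
    moreover define m where
      "m = min (2 * int x) (min (2 * c 0 N) (int x - (int N - c 0 N) + int (Suc t)))"
    have m: "m \<le> 2 * int x" "m \<le> 2 * c 0 N" "m \<le> int x - (int N - c 0 N) + int (Suc t)"
      unfolding m_def by linarith+
    have "m - 2 \<le> min (2 * int y) (min (2 * c 0 N) (int y - (int N - c 0 N) + int t))"
      using m y by simp
    then have "m - 2 \<le> 2 * c t y"
      using Suc.IH[of y] 3 y by (meson Suc_leD less_imp_le order_trans)
    moreover have "m \<le> min (2 * int (Suc x)) (min (2 * c 0 N) (int (Suc x) - (int N - c 0 N) + int t))"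
      using m by simp
    then have "m \<le> 2 * c t (Suc x)"
      using Suc.IH[of "Suc x"] 3 by (meson Suc_leI order_trans)
    ultimately show ?thesis
      unfolding m_def[symmetric] by linarith
  qed
  with total show ?case by simp
qed

text \<open>Let \<open>K\<close> be the number of labels. Once \<open>t\<close> reaches
  \<open>N\<close>, the third term of the bound is at least \<open>x + K\<close>, hence at least
  twice \<open>min x K\<close>. Since \<open>min x K\<close> also bounds the height from above, the
  row is sorted, labels first.\<close>

lemma slide_pow_sorted:
  assumes "N \<le> t" and "x < N"
  shows "(slide {s..<s + N} ^^ t) w (s + x) \<longleftrightarrow> x < count_below s w N"
proof -
  define w' where "w' = (slide {s..<s + N} ^^ t) w"
  have N: "count_below s w' N = count_below s w N"
    using count_below_slide_pow_ge[of N N s t w] by (simp add: w'_def)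
  have eq: "count_below s w' y = min y (count_below s w N)" if "y \<le> N" for y
  proof -
    have "count_below s w' y \<le> y" "count_below s w' y \<le> count_below s w N"
      using count_below_le[of s w' y] count_below_mono[OF that, of s w'] N by auto
    moreover have "min (2 * int y) (min (2 * int (count_below s w N))
        (int y - (int N - int (count_below s w N)) + int t)) \<le> 2 * int (count_below s w' y)"
      using count_below_slide_pow_ge[OF that, of s t w] by (simp add: w'_def)
    ultimately show ?thesis
      using \<open>N \<le> t\<close> by linarith
  qed
  show ?thesis
    using eq[of x] eq[of "Suc x"] \<open>x < N\<close> unfolding w'_def[symmetric]
    by (cases "w' (s + x)") auto
qed

text \<open>Convexity makes \<open>F\<close> a block \<open>{s..<s + N}\<close> with
  \<open>N = card F\<close>. The right-hand side is the test by which \<open>bk\<close> fills the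
  free positions.\<close>

lemma slide_pow_interval:
  assumes "finite F" and "\<And>i j k. i \<in> F \<Longrightarrow> k \<in> F \<Longrightarrow> i \<le> j \<Longrightarrow> j \<le> k \<Longrightarrow> j \<in> F"
    and "card F \<le> t" and "k \<in> F"
  shows "(slide F ^^ t) w k \<longleftrightarrow> card {j \<in> F. j < k} < card {j \<in> F. w j}"
proof -
  define s where "s = Min F"
  have "s \<in> F" "Max F \<in> F"
    unfolding s_def using assms(1,4) by (auto intro: Min_in Max_in)
  then have mem: "j \<in> F \<longleftrightarrow> s \<le> j \<and> j \<le> Max F" for j
    using assms(2)[of s "Max F" j] Min_le[OF assms(1), of j] Max_ge[OF assms(1), of j]
    unfolding s_def by blast
  define N where "N = Suc (Max F) - s"
  have "s + N = Suc (Max F)"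
    using Max_ge[OF assms(1) \<open>s \<in> F\<close>] by (simp add: N_def)
  then have F: "F = {s..<s + N}"
    using mem by (metis (no_types, lifting) atLeastLessThan_iff less_Suc_eq_le set_eqI)
  obtain x where x: "k = s + x" "x < N"
    using \<open>k \<in> F\<close> that[of "k - s"] unfolding F by auto
  have "{j \<in> F. j < k} = {s..<s + x}"
    using x unfolding F by auto
  then show ?thesis
    using slide_pow_sorted[of N t x s w] x \<open>card F \<le> t\<close> unfolding F count_below_def by simp
qed

section \<open>Labelings of a skew strip\<close>

locale poset_strip =
  fixes P :: "'a::order set" and l :: nat and u v :: "'a \<Rightarrow> nat"
  assumes shape_mono: "\<And>p p'. p \<in> P \<Longrightarrow> p' \<in> P \<Longrightarrow> p \<le> p' \<Longrightarrow> v p \<le> v p' \<and> u p' \<le> u p"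
begin

abbreviation D where "D \<equiv> P_dom P l u v"

abbreviation labelings where "labelings q \<equiv> P_strict P l u v (\<lambda>_. {1..q})"

text \<open>Going up in \<open>P\<close> moves both ends of a fiber weakly to the left. This and
  \<open>dom_right\<close> let a comparison in one column be carried to another.\<close>

lemma dom_left: "(p, i) \<in> D \<Longrightarrow> (p', j) \<in> D \<Longrightarrow> p \<le> p' \<Longrightarrow> i \<le> j \<Longrightarrow> (p', i) \<in> D"
  using shape_mono[of p p'] by (auto simp: P_dom_def)

lemma dom_right: "(p, i) \<in> D \<Longrightarrow> (p', j) \<in> D \<Longrightarrow> p \<le> p' \<Longrightarrow> i \<le> j \<Longrightarrow> (p, j) \<in> D"
  using shape_mono[of p p'] by (auto simp: P_dom_def)

lemma dom_between: "(p, i) \<in> D \<Longrightarrow> (p', i) \<in> D \<Longrightarrow> p \<le> z \<Longrightarrow> z \<le> p' \<Longrightarrow> z \<in> P \<Longrightarrow> (z, i) \<in> D"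
  using shape_mono[of p z] shape_mono[of z p'] by (auto simp: P_dom_def)

lemma dom_row: "(p, i) \<in> D \<Longrightarrow> (p, k) \<in> D \<Longrightarrow> i \<le> j \<Longrightarrow> j \<le> k \<Longrightarrow> (p, j) \<in> D"
  by (auto simp: P_dom_def)

lemma dom_bounds: "(p, i) \<in> D \<Longrightarrow> p \<in> P \<and> 1 \<le> i \<and> i \<le> l"
  by (auto simp: P_dom_def)

text \<open>\<open>Rq\<close> collects exactly the labels attained by such labelings, so restricting
  to it excludes none of them.\<close>

lemma P_strict_Rq: "P_strict P l u v (Rq P l u v q) = labelings q"
  unfolding P_strict_def Rq_def by (auto 0 3)

lemma labelings_column:
  "f \<in> labelings q \<Longrightarrow> (p, i) \<in> D \<Longrightarrow> (p', i) \<in> D \<Longrightarrow> p < p' \<Longrightarrow> f (p, i) < f (p', i)"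
  by (auto simp: P_strict_def)

lemma labelings_row:
  "f \<in> labelings q \<Longrightarrow> (p, i) \<in> D \<Longrightarrow> (p, j) \<in> D \<Longrightarrow> i \<le> j \<Longrightarrow> f (p, i) \<le> f (p, j)"
  by (auto simp: P_strict_def)

lemma labelings_range: "f \<in> labelings q \<Longrightarrow> (p, i) \<in> D \<Longrightarrow> 1 \<le> f (p, i) \<and> f (p, i) \<le> q"
  by (auto simp: P_strict_def)

lemma labelings_extensional: "f \<in> labelings q \<Longrightarrow> f \<in> extensional D"
  by (auto simp: P_strict_def)

lemma in_RqI: "f \<in> labelings q \<Longrightarrow> (p, i) \<in> D \<Longrightarrow> f (p, i) \<in> Rq P l u v q p"
  using labelings_range[of f q p i] by (auto simp: Rq_def)

lemma finite_Rq: "finite (Rq P l u v q p)"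
  by (rule finite_subset[of _ "{1..q}"]) (auto simp: Rq_def)

section \<open>Raising and lowering a single label\<close>

text \<open>The raised labeling serves twice: it witnesses raisability, and it shows that
  \<open>Rq\<close> has no gap just above a raisable label.\<close>

lemma raise_label:
  assumes f: "f \<in> labelings q" and D: "(p, i) \<in> D" and "f (p, i) < q"
    and above: "\<And>p'. p < p' \<Longrightarrow> (p', i) \<in> D \<Longrightarrow> f (p, i) + 1 < f (p', i)"
  shows "raisable P l u v (Rq P l u v q) f p i \<and> f (p, i) + 1 \<in> Rq P l u v q p"
proof -
  \<comment> \<open>Everything from \<open>i\<close> rightwards in the fiber of \<open>p\<close> is
    pushed up to at least \<open>f (p, i) + 1\<close>, which keeps the row weakly increasing. The
    guard \<open>(p, j) \<in> D\<close> keeps \<open>g\<close> extensional.\<close>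
  define g where
    "g = (\<lambda>(p', j). if p' = p \<and> (p, j) \<in> D \<and> i \<le> j then max (f (p, j)) (f (p, i) + 1) else f (p', j))"
  have g_ge: "f z \<le> g z" for z
    by (auto simp: g_def split: prod.split)
  have "g \<in> labelings q"
    unfolding P_strict_def
  proof (intro CollectI conjI allI impI)
    show "g \<in> extensional D"
      using labelings_extensional[OF f] by (auto simp: g_def extensional_def)
  next
    fix p1 p2 j
    assume D12: "(p1, j) \<in> D" "(p2, j) \<in> D" and "p1 < p2"
    have less: "f (p1, j) < f (p2, j)"
      using labelings_column[OF f D12 \<open>p1 < p2\<close>] .
    show "g (p1, j) < g (p2, j)"
    proof (cases "p1 = p \<and> i \<le> j")
      case True
      \<comment> \<open>The hypothesis speaks of column \<open>i\<close> only; \<open>p2\<close>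
        also occurs there, and row monotonicity carries the inequality on to column
        \<open>j\<close>.\<close>
      then have "(p2, i) \<in> D"
        using dom_left D D12 \<open>p1 < p2\<close> by (metis less_imp_le)
      then have "f (p, i) + 1 < f (p2, j)"
        using above[of p2] labelings_row[OF f _ D12(2), of i] True \<open>p1 < p2\<close> by force
      then show ?thesis
        using True less \<open>p1 < p2\<close> by (auto simp: g_def)
    next
      case False
      then have "g (p1, j) = f (p1, j)"
        by (auto simp: g_def)
      then show ?thesis
        using less g_ge[of "(p2, j)"] by simp
    qed
  next
    fix p' j k
    assume "(p', j) \<in> D" "(p', k) \<in> D" "j \<le> k"
    then show "g (p', j) \<le> g (p', k)"
      using labelings_row[OF f, of p' j k] by (auto simp: g_def)
  next
    fix p' j
    assume "(p', j) \<in> D"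
    then show "g (p', j) \<in> {1..q}"
      using labelings_range[OF f] \<open>f (p, i) < q\<close> by (force simp: g_def)
  qed
  moreover have g: "g (p, i) = f (p, i) + 1" "\<And>p' j. p' \<noteq> p \<Longrightarrow> g (p', j) = f (p', j)"
    using D by (auto simp: g_def)
  moreover have "raisable P l u v (Rq P l u v q) f p i"
    unfolding raisable_def P_strict_Rq using calculation by (intro bexI[of _ g]) auto
  ultimately show ?thesis
    using in_RqI[of g q p i] D by simp
qed

text \<open>Mirror image of \<open>raise_label\<close>: the labels from \<open>i\<close> leftwards
  are capped at \<open>f (p, i) - 1\<close>.\<close>

lemma lower_label:
  assumes f: "f \<in> labelings q" and D: "(p, i) \<in> D" and "1 < f (p, i)"
    and below: "\<And>p'. p' < p \<Longrightarrow> (p', i) \<in> D \<Longrightarrow> f (p', i) < f (p, i) - 1"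
  shows "lowerable P l u v (Rq P l u v q) f p i \<and> f (p, i) - 1 \<in> Rq P l u v q p"
proof -
  define g where
    "g = (\<lambda>(p', j). if p' = p \<and> (p, j) \<in> D \<and> j \<le> i then min (f (p, j)) (f (p, i) - 1) else f (p', j))"
  have g_le: "g z \<le> f z" for z
    by (auto simp: g_def split: prod.split)
  have "g \<in> labelings q"
    unfolding P_strict_def
  proof (intro CollectI conjI allI impI)
    show "g \<in> extensional D"
      using labelings_extensional[OF f] by (auto simp: g_def extensional_def)
  next
    fix p1 p2 j
    assume D12: "(p1, j) \<in> D" "(p2, j) \<in> D" and "p1 < p2"
    have less: "f (p1, j) < f (p2, j)"
      using labelings_column[OF f D12 \<open>p1 < p2\<close>] .
    show "g (p1, j) < g (p2, j)"
    proof (cases "p2 = p \<and> j \<le> i")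
      case True
      then have "(p1, i) \<in> D"
        using dom_right D D12 \<open>p1 < p2\<close> by (metis less_imp_le)
      then have "f (p1, j) < f (p, i) - 1"
        using below[of p1] labelings_row[OF f D12(1), of i] True \<open>p1 < p2\<close> by force
      then show ?thesis
        using True less \<open>p1 < p2\<close> by (auto simp: g_def)
    next
      case False
      then have "g (p2, j) = f (p2, j)"
        by (auto simp: g_def)
      then show ?thesis
        using less g_le[of "(p1, j)"] by simp
    qed
  next
    fix p' j k
    assume "(p', j) \<in> D" "(p', k) \<in> D" "j \<le> k"
    then show "g (p', j) \<le> g (p', k)"
      using labelings_row[OF f, of p' j k] by (auto simp: g_def)
  next
    fix p' j
    assume "(p', j) \<in> D"
    then show "g (p', j) \<in> {1..q}"
      using labelings_range[OF f] \<open>1 < f (p, i)\<close> by (force simp: g_def)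
  qed
  moreover have g: "g (p, i) = f (p, i) - 1" "\<And>p' j. p' \<noteq> p \<Longrightarrow> g (p', j) = f (p', j)"
    using D by (auto simp: g_def)
  moreover have "lowerable P l u v (Rq P l u v q) f p i"
    unfolding lowerable_def P_strict_Rq using calculation by (intro bexI[of _ g]) auto
  ultimately show ?thesis
    using in_RqI[of g q p i] D by simp
qed

text \<open>A witness agrees with \<open>f\<close> off the fiber of \<open>p\<close>, so the labels
  above in column \<open>i\<close> must leave room for at least \<open>f (p, i) + 1\<close>.
  Conversely, this room suffices by \<open>raise_label\<close>.\<close>

lemma raisable_iff:
  assumes f: "f \<in> labelings q" and D: "(p, i) \<in> D"
  shows "raisable P l u v (Rq P l u v q) f p i \<longleftrightarrow>
    f (p, i) < q \<and> (\<forall>p'. p < p' \<longrightarrow> (p', i) \<in> D \<longrightarrow> f (p, i) + 1 < f (p', i))"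
    (is "?L \<longleftrightarrow> ?R")
proof
  assume ?L
  then obtain g where g: "g \<in> labelings q" "f (p, i) < g (p, i)"
    "\<And>p' i'. (p', i') \<in> D \<Longrightarrow> p' \<noteq> p \<Longrightarrow> g (p', i') = f (p', i')"
    unfolding raisable_def P_strict_Rq by blast
  have "f (p, i) + 1 < f (p', i)" if "p < p'" "(p', i) \<in> D" for p'
    using labelings_column[OF g(1) D that(2,1)] g(2) g(3)[OF that(2)] that(1) by force
  then show ?R
    using labelings_range[OF g(1) D] g(2) by auto
next
  assume ?R
  then show ?L
    using raise_label[OF f D] by blast
qed

lemma lowerable_iff:
  assumes f: "f \<in> labelings q" and D: "(p, i) \<in> D"
  shows "lowerable P l u v (Rq P l u v q) f p i \<longleftrightarrow>
    1 < f (p, i) \<and> (\<forall>p'. p' < p \<longrightarrow> (p', i) \<in> D \<longrightarrow> f (p', i) < f (p, i) - 1)"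
    (is "?L \<longleftrightarrow> ?R")
proof
  assume ?L
  then obtain g where g: "g \<in> labelings q" "g (p, i) < f (p, i)"
    "\<And>p' i'. (p', i') \<in> D \<Longrightarrow> p' \<noteq> p \<Longrightarrow> g (p', i') = f (p', i')"
    unfolding lowerable_def P_strict_Rq by blast
  have "f (p', i) < f (p, i) - 1" if "p' < p" "(p', i) \<in> D" for p'
    using labelings_column[OF g(1) that(2) D that(1)] g(2) g(3)[OF that(2)] that(1) by force
  then show ?R
    using labelings_range[OF g(1) D] g(2) by auto
next
  assume ?R
  then show ?L
    using lower_label[OF f D] by blast
qed

section \<open>Bender--Knuth involutions\<close>

text \<open>A purely vertical criterion, without \<open>q\<close> and \<open>Rq\<close>, which can
  be compared directly with jeu de taquin. It ranges over all comparable elements;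
  \<open>covers_in_consecutive\<close> passes to covers.\<close>

definition free :: "('a \<times> nat \<Rightarrow> int) \<Rightarrow> int \<Rightarrow> 'a \<Rightarrow> nat set" where
  "free f a p = {i. (p, i) \<in> D \<and>
     (f (p, i) = a \<and> (\<forall>p'. p < p' \<longrightarrow> (p', i) \<in> D \<longrightarrow> f (p', i) \<noteq> a + 1) \<or>
      f (p, i) = a + 1 \<and> (\<forall>p'. p' < p \<longrightarrow> (p', i) \<in> D \<longrightarrow> f (p', i) \<noteq> a))}"

definition bk :: "int \<Rightarrow> ('a \<times> nat \<Rightarrow> int) \<Rightarrow> 'a \<times> nat \<Rightarrow> int" where
  "bk a f = (\<lambda>(p, i) \<in> D.
     if i \<in> free f a p
     then (if card {j \<in> free f a p. j < i} < card {j \<in> free f a p. f (p, j) = a + 1} then a else a + 1)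
     else f (p, i))"

lemma free_iff:
  assumes f: "f \<in> labelings q" and "1 \<le> a" "a < q"
  shows "i \<in> free f a p \<longleftrightarrow> (p, i) \<in> D \<and>
    (f (p, i) = a \<and> raisable P l u v (Rq P l u v q) f p i \<or>
     f (p, i) = a + 1 \<and> lowerable P l u v (Rq P l u v q) f p i)"
proof (cases "(p, i) \<in> D")
  case True
  have "(\<forall>p'. p < p' \<longrightarrow> (p', i) \<in> D \<longrightarrow> f (p', i) \<noteq> a + 1) \<longleftrightarrow>
      (\<forall>p'. p < p' \<longrightarrow> (p', i) \<in> D \<longrightarrow> a + 1 < f (p', i))" if "f (p, i) = a"
    using labelings_column[OF f True] that by force
  moreover have "(\<forall>p'. p' < p \<longrightarrow> (p', i) \<in> D \<longrightarrow> f (p', i) \<noteq> a) \<longleftrightarrow>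
      (\<forall>p'. p' < p \<longrightarrow> (p', i) \<in> D \<longrightarrow> f (p', i) < a)" if "f (p, i) = a + 1"
    using labelings_column[OF f _ True] that by force
  ultimately show ?thesis
    using True assms by (auto simp: free_def raisable_iff[OF f True] lowerable_iff[OF f True])
qed (simp add: free_def)

text \<open>Used contrapositively: in a fiber whose range misses \<open>a\<close> or
  \<open>a + 1\<close>, nothing is free and \<open>bk\<close> acts trivially.\<close>

lemma free_in_Rq:
  assumes f: "f \<in> labelings q" and "1 \<le> a" "a < q" and "i \<in> free f a p"
  shows "a \<in> Rq P l u v q p \<and> a + 1 \<in> Rq P l u v q p"
proof -
  have D: "(p, i) \<in> D"
    using assms by (simp add: free_def)
  from assms(4) consider "f (p, i) = a" "raisable P l u v (Rq P l u v q) f p i"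
    | "f (p, i) = a + 1" "lowerable P l u v (Rq P l u v q) f p i"
    unfolding free_iff[OF assms(1-3)] by blast
  then show ?thesis
  proof cases
    case 1
    then have "f (p, i) + 1 \<in> Rq P l u v q p"
      using raise_label[OF f D] raisable_iff[OF f D] by blast
    then show ?thesis
      using in_RqI[OF f D] 1 by simp
  next
    case 2
    then have "f (p, i) - 1 \<in> Rq P l u v q p"
      using lower_label[OF f D] lowerable_iff[OF f D] by blast
    then show ?thesis
      using in_RqI[OF f D] 2 by simp
  qed
qed

text \<open>The range \<open>R\<^sup>q(p)\<close> may have gaps, but labels next to a gap are never free, so
  \<open>R_next\<close> can be replaced by the successor.\<close>

lemma bender_knuth_eq_bk:
  assumes f: "f \<in> labelings q" and a: "1 \<le> a" "a < q"
  shows "bender_knuth P l u v (Rq P l u v q) a f = bk a f"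
proof
  fix z :: "'a \<times> nat"
  obtain p i where z: "z = (p, i)"
    by force
  let ?R = "Rq P l u v q" and ?nx = "R_next (Rq P l u v q) p a"
  show "bender_knuth P l u v ?R a f z = bk a f z"
  proof (cases "a \<in> ?R p \<and> a + 1 \<in> ?R p")
    case True
    have "?nx = a + 1"
      unfolding R_next_def using True finite_Rq[of q p] by (intro Min_eqI) auto
    moreover have "a \<noteq> Max (?R p)"
      using True Max_ge[OF finite_Rq[of q p], of "a + 1"] by auto
    moreover have "free_pos P l u v ?R a f p = free f a p"
      unfolding free_pos_def \<open>?nx = a + 1\<close> by (rule set_eqI) (simp add: free_iff[OF f a])
    ultimately show ?thesis
      using True by (simp add: z bender_knuth_def bk_def)
  next
    case False
    then have bk: "free f a p = {}"
      using free_in_Rq[OF f a] by blast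
    \<comment> \<open>Here \<open>a + 1\<close> is missing from the range. A raisable
      \<open>a\<close> would put it there; a lowerable \<open>?nx\<close> would put
      \<open>?nx - 1\<close> there, contradicting the minimality of \<open>?nx\<close>.\<close>
    have "i \<notin> free_pos P l u v ?R a f p" if "a \<in> ?R p" "a \<noteq> Max (?R p)"
    proof
      assume i: "i \<in> free_pos P l u v ?R a f p"
      then have D: "(p, i) \<in> D"
        by (simp add: free_pos_def)
      have "{m \<in> ?R p. a < m} \<noteq> {}"
        using that finite_Rq[of q p] by (metis (no_types, lifting) Max_ge Max_in empty_Collect_eq empty_iff order_le_less)
      then have nx: "?nx \<in> ?R p" "a < ?nx" and least: "\<And>m. m \<in> ?R p \<Longrightarrow> a < m \<Longrightarrow> ?nx \<le> m"
        using Min_in[of "{m \<in> ?R p. a < m}"] finite_Rq[of q p] by (auto simp: R_next_def)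
      from i consider "f (p, i) = a" "raisable P l u v ?R f p i"
        | "f (p, i) = ?nx" "lowerable P l u v ?R f p i"
        by (auto simp: free_pos_def)
      then show False
      proof cases
        case 1
        then have "a + 1 \<in> ?R p"
          using raise_label[OF f D] raisable_iff[OF f D] by auto
        with False that show False by simp
      next
        case 2
        then have "?nx - 1 \<in> ?R p"
          using lower_label[OF f D] lowerable_iff[OF f D] by auto
        then show False
          using least[of "?nx - 1"] nx False that by (cases "?nx = a + 1") auto
      qed
    qed
    then show ?thesis
      using bk by (auto simp: z bender_knuth_def bk_def Let_def)
  qed
qed

text \<open>Outside \<open>1 \<le> a < q\<close>, a label \<open>a\<close> in the range of a fiber
  can only be \<open>q\<close>, its maximum. This makes the bi-infinite product finite.\<close>

lemma bender_knuth_trivial: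
  assumes f: "f \<in> labelings q" and a: "\<not> (1 \<le> a \<and> a < q)"
  shows "bender_knuth P l u v (Rq P l u v q) a f = f"
proof -
  have "a = Max (Rq P l u v q p)" if "a \<in> Rq P l u v q p" for p
    using that a finite_Rq by (intro Max_eqI[symmetric]) (auto simp: Rq_def)
  then have "bender_knuth P l u v (Rq P l u v q) a f = restrict f D"
    unfolding bender_knuth_def Let_def by (intro restrict_ext) (auto split: prod.split)
  then show ?thesis
    using extensional_restrict[OF labelings_extensional[OF f]] by simp
qed

section \<open>The free positions of a fiber form an interval\<close>

text \<open>If an \<open>a + 1\<close> above blocks \<open>j\<close>, the same element occurs in
  column \<open>i\<close>, where its label is squeezed to \<open>a + 1\<close> and blocks
  \<open>i\<close>. So the blocked labels \<open>a\<close> come first; dually,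
  \<open>free_upper_left\<close> puts the blocked labels \<open>a + 1\<close> last.\<close>

lemma free_lower_right:
  assumes "f \<in> labelings q" and "(p, i) \<in> D" "(p, j) \<in> D" "i \<le> j"
    and "f (p, i) = a" "f (p, j) = a" and "i \<in> free f a p"
  shows "j \<in> free f a p"
proof -
  have "f (p', j) \<noteq> a + 1" if "p < p'" "(p', j) \<in> D" for p'
  proof
    assume "f (p', j) = a + 1"
    moreover have D: "(p', i) \<in> D"
      using dom_left[OF assms(2) that(2)] that(1) assms(4) by simp
    ultimately have "f (p', i) = a + 1"
      using labelings_column[OF assms(1,2) D that(1)] labelings_row[OF assms(1) D that(2) assms(4)]
        assms(5) by simp
    then show False
      using assms(5,7) D that by (auto simp: free_def)
  qed
  then show ?thesis
    using assms(3,6) by (simp add: free_def)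
qed

lemma free_upper_left:
  assumes "f \<in> labelings q" and "(p, i) \<in> D" "(p, j) \<in> D" "i \<le> j"
    and "f (p, i) = a + 1" "f (p, j) = a + 1" and "j \<in> free f a p"
  shows "i \<in> free f a p"
proof -
  have "f (p', i) \<noteq> a" if "p' < p" "(p', i) \<in> D" for p'
  proof
    assume "f (p', i) = a"
    moreover have D: "(p', j) \<in> D"
      using dom_right[OF that(2) assms(3)] that(1) assms(4) by simp
    ultimately have "f (p', j) = a"
      using labelings_column[OF assms(1) D assms(3) that(1)]
        labelings_row[OF assms(1) that(2) D assms(4)] assms(6) by simp
    then show False
      using assms(6,7) D that by (auto simp: free_def)
  qed
  then show ?thesis
    using assms(2,5) by (simp add: free_def)
qed

lemma free_dom: "i \<in> free f a p \<Longrightarrow> (p, i) \<in> D"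
  and free_label: "i \<in> free f a p \<Longrightarrow> f (p, i) = a \<or> f (p, i) = a + 1"
  by (auto simp: free_def)

lemma free_subset: "free f a p \<subseteq> {1..l}"
  by (auto dest!: free_dom dom_bounds)

lemma finite_free: "finite (free f a p)"
  using finite_subset[OF free_subset] by simp

lemma card_free: "card (free f a p) \<le> l"
  using card_mono[OF _ free_subset, of f a p] by simp

lemma free_convex:
  assumes f: "f \<in> labelings q" and i: "i \<in> free f a p" and k: "k \<in> free f a p" and "i \<le> j" "j \<le> k"
  shows "j \<in> free f a p"
proof -
  have D: "(p, j) \<in> D"
    using dom_row[OF free_dom[OF i] free_dom[OF k]] assms by blast
  have "f (p, i) \<le> f (p, j)" "f (p, j) \<le> f (p, k)"
    using labelings_row[OF f] D free_dom[OF i] free_dom[OF k] assms by blast+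
  then consider "f (p, i) = a" "f (p, j) = a" | "f (p, j) = a + 1" "f (p, k) = a + 1"
    using free_label[OF i] free_label[OF k] by linarith
  then show ?thesis
    using free_lower_right[OF f free_dom[OF i] D] free_upper_left[OF f D free_dom[OF k]] assms
    by cases blast+
qed

lemma bk_cases:
  assumes "(p, i) \<in> D"
  obtains "i \<notin> free f a p" "bk a f (p, i) = f (p, i)"
  | "i \<in> free f a p" "f (p, i) \<in> {a, a + 1}" "bk a f (p, i) \<in> {a, a + 1}"
proof (cases "i \<in> free f a p")
  case True
  then have "bk a f (p, i) \<in> {a, a + 1}"
    using assms by (simp add: bk_def)
  then show ?thesis
    using that(2) True free_label[OF True] by blast
next
  case False
  then show ?thesis
    using that(1) assms by (simp add: bk_def)
qed

text \<open>Strictness of columns forces \<open>a\<close> below \<open>a + 1\<close>, and then each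
  blocks the other.\<close>

lemma column_blocked:
  assumes "f \<in> labelings q" and "(p, i) \<in> D" "(p', i) \<in> D" "p < p'"
    and "f (p, i) \<in> {a, a + 1}" "f (p', i) \<in> {a, a + 1}"
  shows "f (p, i) = a \<and> f (p', i) = a + 1 \<and> i \<notin> free f a p \<and> i \<notin> free f a p'"
  using labelings_column[OF assms(1-4)] assms by (auto simp: free_def)

lemma bk_labelings:
  assumes f: "f \<in> labelings q" and a: "1 \<le> a" "a < q"
  shows "bk a f \<in> labelings q"
  unfolding P_strict_def
proof (intro CollectI conjI allI impI)
  show "bk a f \<in> extensional D"
    by (simp add: bk_def)
next
  fix p p' i
  assume D: "(p, i) \<in> D" "(p', i) \<in> D" and less: "p < p'"
  show "bk a f (p, i) < bk a f (p', i)"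
  \<comment> \<open>Two labels of the pair \<open>a\<close>, \<open>a + 1\<close> block each other
    and stay fixed. Otherwise at most one of the two labels changes, within the pair, while the
    other lies outside it.\<close>
  proof (cases "f (p, i) \<in> {a, a + 1} \<and> f (p', i) \<in> {a, a + 1}")
    case True
    then have "i \<notin> free f a p" "i \<notin> free f a p'"
      using column_blocked[OF f D less] by blast+
    then show ?thesis
      using labelings_column[OF f D less] D by (simp add: bk_def)
  next
    case False
    then show ?thesis
      using labelings_column[OF f D less]
      by (cases rule: bk_cases[OF D(1), of f a]; cases rule: bk_cases[OF D(2), of f a]; simp; linarith?)
  qed
next
  fix p i j
  assume D: "(p, i) \<in> D" "(p, j) \<in> D" and le: "i \<le> j"
  note row = labelings_row[OF f D le]
  show "bk a f (p, i) \<le> bk a f (p, j)"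
  \<comment> \<open>A blocked \<open>a + 1\<close> cannot precede a free position, nor a blocked
    \<open>a\<close> follow one; so only free positions compete, and they are filled in increasing
    order.\<close>
  proof (cases rule: bk_cases[OF D(1), of f a]; cases rule: bk_cases[OF D(2), of f a])
    assume "i \<in> free f a p" "j \<in> free f a p"
    moreover have "card {k \<in> free f a p. k < i} \<le> card {k \<in> free f a p. k < j}"
      using le finite_free by (intro card_mono) auto
    ultimately show ?thesis
      using D by (auto simp: bk_def)
  next
    assume "i \<notin> free f a p" "bk a f (p, i) = f (p, i)"
      "j \<in> free f a p" "f (p, j) \<in> {a, a + 1}" "bk a f (p, j) \<in> {a, a + 1}"
    then show ?thesis
      using row free_upper_left[OF f D le, of a] by (cases "f (p, i) = a + 1") auto
  next
    assume "j \<notin> free f a p" "bk a f (p, j) = f (p, j)"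
      "i \<in> free f a p" "f (p, i) \<in> {a, a + 1}" "bk a f (p, i) \<in> {a, a + 1}"
    then show ?thesis
      using row free_lower_right[OF f D le, of a] by (cases "f (p, j) = a") auto
  qed (use row in auto)
next
  fix p i
  assume "(p, i) \<in> D"
  then show "bk a f (p, i) \<in> {1..q}"
    using labelings_range[OF f, of p i] a by (auto simp: bk_def)
qed

section \<open>Jeu de taquin\<close>

text \<open>After one step, the boxes and the labels \<open>a + 1\<close> that block each other vertically have
  been exchanged for good; \<open>w p\<close> marks the labels \<open>a + 1\<close> among the free positions of a row.\<close>

definition jdt_state ::
  "('a \<times> nat \<Rightarrow> int) \<Rightarrow> int \<Rightarrow> ('a \<times> nat \<Rightarrow> int option) \<Rightarrow> ('a \<Rightarrow> nat \<Rightarrow> bool) \<Rightarrow> 'a \<times> nat \<Rightarrow> int option"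
  where
  "jdt_state f a g w = (\<lambda>(p, k) \<in> D.
     if f (p, k) \<noteq> a \<and> f (p, k) \<noteq> a + 1 then g (p, k)
     else if (if k \<in> free f a p then w p k else f (p, k) = a) then Some (a + 1) else None)"

text \<open>\<open>jdt_step\<close> for \<open>a + 1\<close> looks only at boxes and labels
  \<open>a + 1\<close>, so \<open>g\<close> is unconstrained on all other labels, in particular on
  those already shifted.\<close>

definition encodes :: "('a \<times> nat \<Rightarrow> int option) \<Rightarrow> int \<Rightarrow> ('a \<times> nat \<Rightarrow> int) \<Rightarrow> bool" where
  "encodes g a f \<longleftrightarrow>
     (\<forall>z \<in> D. (g z = None \<longleftrightarrow> f z = a) \<and> (g z = Some (a + 1) \<longleftrightarrow> f z = a + 1))"

text \<open>An element strictly between would lie in the same column and carry an integer strictly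
  between \<open>a\<close> and \<open>a + 1\<close>.\<close>

lemma covers_in_consecutive:
  assumes "f \<in> labelings q" and "(p, i) \<in> D" "(p', i) \<in> D" "p < p'" and "f (p, i) = a" "f (p', i) = a + 1"
  shows "covers_in P p p'"
proof -
  have False if "z \<in> P" "p < z" "z < p'" for z
    using dom_between[OF assms(2,3), of z] labelings_column[OF assms(1), of p i z]
      labelings_column[OF assms(1), of z i p'] assms that by auto
  then show ?thesis
    using assms dom_bounds by (auto simp: covers_in_def)
qed

lemma covers_in_less: "covers_in P p p' \<Longrightarrow> p < p'"
  by (simp add: covers_in_def)

lemma jdt_state_None:
  assumes "encodes g a f" "(p, k) \<in> D"
  shows "jdt_state f a g w (p, k) = None \<longleftrightarrow>
    f (p, k) \<in> {a, a + 1} \<and> (if k \<in> free f a p then \<not> w p k else f (p, k) = a + 1)"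
  using assms by (auto simp: jdt_state_def encodes_def)

lemma jdt_state_Some:
  assumes "encodes g a f" "(p, k) \<in> D"
  shows "jdt_state f a g w (p, k) = Some (a + 1) \<longleftrightarrow>
    f (p, k) \<in> {a, a + 1} \<and> (if k \<in> free f a p then w p k else f (p, k) = a)"
  using assms by (auto simp: jdt_state_def encodes_def)

text \<open>Once the blocked pairs have been exchanged, the vertical clauses never fire, and the
  horizontal ones act on each free block as one \<open>slide\<close>.\<close>

lemma jdt_step_state:
  assumes f: "f \<in> labelings q" and g: "encodes g a f"
  shows "jdt_step P l u v (a + 1) (jdt_state f a g w) = jdt_state f a g (\<lambda>p. slide (free f a p) (w p))"
proof
  fix z :: "'a \<times> nat"
  obtain p k where z: "z = (p, k)"
    by force
  let ?g = "jdt_state f a g w"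
  note None = jdt_state_None[OF g] and Some = jdt_state_Some[OF g]
  show "jdt_step P l u v (a + 1) ?g z = jdt_state f a g (\<lambda>p. slide (free f a p) (w p)) z"
  proof (cases "(p, k) \<in> D")
    case D: True
    have no_column: "\<not> (?g (p1, i) = None \<and> ?g (p2, i) = Some (a + 1))"
      if "covers_in P p1 p2" "(p1, i) \<in> D" "(p2, i) \<in> D" for p1 p2 i
    proof
      assume A: "?g (p1, i) = None \<and> ?g (p2, i) = Some (a + 1)"
      then have "f (p1, i) = a \<and> i \<notin> free f a p1"
        using column_blocked[OF f that(2,3) covers_in_less[OF that(1)]] None[OF that(2)] Some[OF that(3)]
        by blast
      then show False
        using A None[OF that(2)] by simp
    qed
    \<comment> \<open>A row now shows labels on the blocked \<open>a\<close>, then \<open>w\<close>,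
      then boxes on the blocked \<open>a + 1\<close>; a box followed by a label therefore lies
      inside the free block.\<close>
    have row: "?g (p, i) = None \<and> ?g (p, i + 1) = Some (a + 1) \<longleftrightarrow>
        i \<in> free f a p \<and> i + 1 \<in> free f a p \<and> \<not> w p i \<and> w p (i + 1)"
      if D': "(p, i) \<in> D" "(p, i + 1) \<in> D" for i
    proof
      assume A: "?g (p, i) = None \<and> ?g (p, i + 1) = Some (a + 1)"
      have le: "f (p, i) \<le> f (p, i + 1)"
        using labelings_row[OF f D'] by simp
      have N: "f (p, i) \<in> {a, a + 1}" "if i \<in> free f a p then \<not> w p i else f (p, i) = a + 1"
        and S: "f (p, i + 1) \<in> {a, a + 1}"
          "if i + 1 \<in> free f a p then w p (i + 1) else f (p, i + 1) = a"
        using A None[OF D'(1)] Some[OF D'(2)] by blast+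
      have i: "i \<in> free f a p"
      proof (rule ccontr)
        assume i: "i \<notin> free f a p"
        then have "f (p, i) = a + 1" "f (p, i + 1) = a + 1"
          using N S le by auto
        then show False
          using free_upper_left[OF f D', of a] i S by (simp split: if_splits)
      qed
      moreover have "i + 1 \<in> free f a p"
      proof (rule ccontr)
        assume i': "i + 1 \<notin> free f a p"
        then have "f (p, i) = a" "f (p, i + 1) = a"
          using N S le by auto
        then show False
          using free_lower_right[OF f D', of a] i i' by simp
      qed
      ultimately show "i \<in> free f a p \<and> i + 1 \<in> free f a p \<and> \<not> w p i \<and> w p (i + 1)"
        using N S by simp
    next
      assume "i \<in> free f a p \<and> i + 1 \<in> free f a p \<and> \<not> w p i \<and> w p (i + 1)"
      then show "?g (p, i) = None \<and> ?g (p, i + 1) = Some (a + 1)"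
        using None[OF D'(1)] Some[OF D'(2)] free_label by simp
    qed
    \<comment> \<open>Free positions have no box or label \<open>a + 1\<close> as a vertical
      obstacle, so the cover conditions of the horizontal clauses hold automatically.\<close>
    have free_below: "?g (p', i) \<noteq> None" if "covers_in P p' p" "(p', i) \<in> D" "i \<in> free f a p" for p' i
      using column_blocked[OF f that(2) free_dom[OF that(3)] covers_in_less[OF that(1)], of a]
        None[OF that(2)] free_label[OF that(3)] that(3) by blast
    have free_above: "?g (p', i) \<noteq> Some (a + 1)" if "covers_in P p p'" "(p', i) \<in> D" "i \<in> free f a p" for p' i
      using column_blocked[OF f free_dom[OF that(3)] that(2) covers_in_less[OF that(1)], of a]
        Some[OF that(2)] free_label[OF that(3)] that(3) by blast
    have right: "?g (p, k) = None \<and> (p, k + 1) \<in> D \<and> ?g (p, k + 1) = Some (a + 1) \<and>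
        (\<forall>p'. covers_in P p' p \<longrightarrow> (p', k + 1) \<in> D \<longrightarrow> ?g (p', k + 1) \<noteq> None) \<longleftrightarrow>
        k \<in> free f a p \<and> k + 1 \<in> free f a p \<and> \<not> w p k \<and> w p (k + 1)"
    proof
      assume "k \<in> free f a p \<and> k + 1 \<in> free f a p \<and> \<not> w p k \<and> w p (k + 1)"
      then show "?g (p, k) = None \<and> (p, k + 1) \<in> D \<and> ?g (p, k + 1) = Some (a + 1) \<and>
          (\<forall>p'. covers_in P p' p \<longrightarrow> (p', k + 1) \<in> D \<longrightarrow> ?g (p', k + 1) \<noteq> None)"
        using row[OF D] free_below[of _ "k + 1"] free_dom[of "k + 1"] by metis
    qed (metis row[OF D])
    have left: "?g (p, k) = Some (a + 1) \<and> (p, k - 1) \<in> D \<and> ?g (p, k - 1) = None \<and>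
        (\<forall>p'. covers_in P p p' \<longrightarrow> (p', k - 1) \<in> D \<longrightarrow> ?g (p', k - 1) \<noteq> Some (a + 1)) \<longleftrightarrow>
        k - 1 \<in> free f a p \<and> k \<in> free f a p \<and> \<not> w p (k - 1) \<and> w p k"
    proof -
      have "k - 1 + 1 = k"
        using dom_bounds[OF D] by simp
      then have "?g (p, k - 1) = None \<and> ?g (p, k) = Some (a + 1) \<longleftrightarrow>
          k - 1 \<in> free f a p \<and> k \<in> free f a p \<and> \<not> w p (k - 1) \<and> w p k" if "(p, k - 1) \<in> D"
        using row[OF that] D by metis
      then show ?thesis
        using free_above[of _ "k - 1"] free_dom[of "k - 1" f a p] by metis
    qed
    have "jdt_step P l u v (a + 1) ?g (p, k) =
        (if k \<in> free f a p \<and> k + 1 \<in> free f a p \<and> \<not> w p k \<and> w p (k + 1) then Some (a + 1)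
         else if k - 1 \<in> free f a p \<and> k \<in> free f a p \<and> \<not> w p (k - 1) \<and> w p k then None
         else ?g (p, k))"
    proof -
      have "\<not> (?g (p, k) = None \<and>
          (\<exists>p'. covers_in P p p' \<and> (p', k) \<in> D \<and> ?g (p', k) = Some (a + 1)))"
        and "\<not> (?g (p, k) = Some (a + 1) \<and>
          (\<exists>p'. covers_in P p' p \<and> (p', k) \<in> D \<and> ?g (p', k) = None))"
        using no_column D by blast+
      then show ?thesis
        unfolding jdt_step_def
        by (simp only: restrict_apply case_prod_conv D if_True if_False right left)
    qed
    moreover have "jdt_state f a g w' (p, k) = (if w' p k then Some (a + 1) else None)"
      if "k \<in> free f a p" for w'
      using D that free_label[OF that] by (auto simp: jdt_state_def)
    moreover have "jdt_state f a g (\<lambda>p. slide (free f a p) (w p)) (p, k) = ?g (p, k)"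
      if "k \<notin> free f a p"
      using D that by (simp add: jdt_state_def)
    ultimately show ?thesis
      unfolding z by (cases "k \<in> free f a p") (simp_all add: slide_def)
  next
    case False
    then show ?thesis
      by (simp add: z jdt_step_def jdt_state_def)
  qed
qed

text \<open>The first step is special: the vertical clauses fire exactly at the blocked positions,
  while the free part already undergoes one \<open>slide\<close>.\<close>

lemma jdt_step_initial:
  assumes f: "f \<in> labelings q" and g: "encodes g a f"
  shows "jdt_step P l u v (a + 1) g =
    jdt_state f a g (\<lambda>p. slide (free f a p) (\<lambda>j. f (p, j) = a + 1))"
proof
  fix z :: "'a \<times> nat"
  obtain p k where z: "z = (p, k)"
    by force
  have None: "g (p, i) = None \<longleftrightarrow> f (p, i) = a" and Some: "g (p, i) = Some (a + 1) \<longleftrightarrow> f (p, i) = a + 1"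
    if "(p, i) \<in> D" for p i
    using g that by (auto simp: encodes_def)
  show "jdt_step P l u v (a + 1) g z = jdt_state f a g (\<lambda>p. slide (free f a p) (\<lambda>j. f (p, j) = a + 1)) z"
  proof (cases "(p, k) \<in> D")
    case D: True
    have above: "(\<exists>p'. covers_in P p p' \<and> (p', i) \<in> D \<and> g (p', i) = Some (a + 1)) \<longleftrightarrow> i \<notin> free f a p"
      if "(p, i) \<in> D" "f (p, i) = a" for i
    proof -
      have "(\<exists>p'. covers_in P p p' \<and> (p', i) \<in> D \<and> g (p', i) = Some (a + 1)) \<longleftrightarrow>
          (\<exists>p'. p < p' \<and> (p', i) \<in> D \<and> f (p', i) = a + 1)"
        using Some covers_in_consecutive[OF f that(1) _ _ that(2)] covers_in_less by blast
      then show ?thesis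
        using that by (auto simp: free_def)
    qed
    have below: "(\<exists>p'. covers_in P p' p \<and> (p', i) \<in> D \<and> g (p', i) = None) \<longleftrightarrow> i \<notin> free f a p"
      if "(p, i) \<in> D" "f (p, i) = a + 1" for i
    proof -
      have "(\<exists>p'. covers_in P p' p \<and> (p', i) \<in> D \<and> g (p', i) = None) \<longleftrightarrow>
          (\<exists>p'. p' < p \<and> (p', i) \<in> D \<and> f (p', i) = a)"
        using None covers_in_consecutive[OF f _ that(1) _ _ that(2)] covers_in_less by blast
      then show ?thesis
        using that by (auto simp: free_def)
    qed
    consider "f (p, k) = a" | "f (p, k) = a + 1" | "f (p, k) \<noteq> a" "f (p, k) \<noteq> a + 1"
      by blast
    then show ?thesis
    proof cases
      case 1
      \<comment> \<open>The condition on the lower covers of the right neighbour says that this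
        \<open>a + 1\<close> is free; a blocked one moves vertically instead.\<close>
      have "(p, k + 1) \<in> D \<and> g (p, k + 1) = Some (a + 1) \<and>
          (\<forall>p'. covers_in P p' p \<longrightarrow> (p', k + 1) \<in> D \<longrightarrow> g (p', k + 1) \<noteq> None) \<longleftrightarrow>
          k + 1 \<in> free f a p \<and> f (p, k + 1) = a + 1"
      proof (cases "(p, k + 1) \<in> D \<and> f (p, k + 1) = a + 1")
        case True
        then show ?thesis
          using below[of "k + 1"] Some[of p "k + 1"] by auto
      next
        case False
        then show ?thesis
          using Some[of p "k + 1"] free_dom[of "k + 1"] by blast
      qed
      then show ?thesis
        using 1 D above[OF D 1] None[OF D]
        by (simp add: z jdt_step_def jdt_state_def slide_def del: One_nat_def)
    next
      case 2
      have "(p, k - 1) \<in> D \<and> g (p, k - 1) = None \<and>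
          (\<forall>p'. covers_in P p p' \<longrightarrow> (p', k - 1) \<in> D \<longrightarrow> g (p', k - 1) \<noteq> Some (a + 1)) \<longleftrightarrow>
          k - 1 \<in> free f a p \<and> f (p, k - 1) \<noteq> a + 1"
      proof (cases "(p, k - 1) \<in> D \<and> f (p, k - 1) = a")
        case True
        then show ?thesis
          using above[of "k - 1"] None[of p "k - 1"] by auto
      next
        case False
        then show ?thesis
          using None[of p "k - 1"] free_dom[of "k - 1"] free_label[of "k - 1"] by blast
      qed
      then show ?thesis
        using 2 D below[OF D 2] Some[OF D]
        by (simp add: z jdt_step_def jdt_state_def slide_def del: One_nat_def)
    next
      case 3
      then show ?thesis
        using D None[OF D] Some[OF D] by (simp add: z jdt_step_def jdt_state_def)
    qed
  next
    case False
    then show ?thesis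
      by (simp add: z jdt_step_def jdt_state_def)
  qed
qed

lemma jdt_step_pow:
  assumes f: "f \<in> labelings q" and g: "encodes g a f"
  shows "(jdt_step P l u v (a + 1) ^^ Suc t) g =
    jdt_state f a g (\<lambda>p. (slide (free f a p) ^^ Suc t) (\<lambda>j. f (p, j) = a + 1))"
proof (induction t)
  case 0
  then show ?case
    using jdt_step_initial[OF f g] by simp
next
  case (Suc t)
  then show ?case
    using jdt_step_state[OF f g] by simp
qed

text \<open>A free block has at most \<open>l\<close> positions, so \<open>l\<close> slides sort it.
  The labels \<open>a + 1\<close> end up where \<open>bk\<close> writes \<open>a\<close>, and the
  boxes where it writes \<open>a + 1\<close>.\<close>

lemma jdt_step_pow_bk:
  assumes f: "f \<in> labelings q" and g: "encodes g a f" and "0 < l"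
  shows "(jdt_step P l u v (a + 1) ^^ l) g = (\<lambda>z \<in> D.
    if bk a f z = a then Some (a + 1) else if bk a f z = a + 1 then None else g z)"
proof -
  obtain t where t: "l = Suc t"
    using \<open>0 < l\<close> by (cases l) auto
  have "(slide (free f a p) ^^ l) (\<lambda>j. f (p, j) = a + 1) k \<longleftrightarrow>
      card {j \<in> free f a p. j < k} < card {j \<in> free f a p. f (p, j) = a + 1}"
    if "k \<in> free f a p" for p k
    using free_convex[OF f] that by (intro slide_pow_interval finite_free card_free) blast+
  then have "jdt_state f a g (\<lambda>p. (slide (free f a p) ^^ l) (\<lambda>j. f (p, j) = a + 1)) = (\<lambda>z \<in> D.
      if bk a f z = a then Some (a + 1) else if bk a f z = a + 1 then None else g z)"
    unfolding jdt_state_def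
    by (intro restrict_ext) (auto simp: bk_def dest: free_label)
  then show ?thesis
    using jdt_step_pow[OF f g, of t] by (simp add: t)
qed

text \<open>While jeu de taquin has processed the labels up to \<open>a\<close>, the box plays the role of the
  label \<open>a\<close> of the partial Bender--Knuth product, whose smaller labels are shifted by one.\<close>

definition box_encoding :: "int \<Rightarrow> ('a \<times> nat \<Rightarrow> int) \<Rightarrow> 'a \<times> nat \<Rightarrow> int option" where
  "box_encoding a f = (\<lambda>z \<in> D. if f z = a then None else if f z < a then Some (f z + 1) else Some (f z))"

lemma jdt_step_pow_box_encoding:
  assumes f: "f \<in> labelings q" and "0 < l"
  shows "(jdt_step P l u v (a + 1) ^^ l) (box_encoding a f) = box_encoding (a + 1) (bk a f)"
proof -
  have "encodes (box_encoding a f) a f"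
    by (auto simp: encodes_def box_encoding_def)
  note step = jdt_step_pow_bk[OF f this \<open>0 < l\<close>]
  have "bk a f z = f z \<or> f z \<in> {a, a + 1} \<and> bk a f z \<in> {a, a + 1}" if "z \<in> D" for z
    using that by (cases z) (metis bk_cases)
  then show ?thesis
    unfolding step unfolding box_encoding_def by (intro restrict_ext) force
qed

text \<open>\<open>jdt_step\<close> for \<open>a + 1\<close> is matched with \<open>bk a\<close>,
  hence the index ranges shifted by one. The labeling property is carried along because every stage
  requires it.\<close>

lemma fold_jdt_step:
  assumes f: "f \<in> labelings q" and "0 < l" and "int n < q"
  shows "fold bk [1..int n] f \<in> labelings q \<and>
    fold (\<lambda>i. jdt_step P l u v i ^^ l) [2..int n + 1] (box_encoding 1 f) =
      box_encoding (int n + 1) (fold bk [1..int n] f)"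
  using \<open>int n < q\<close>
proof (induction n)
  case 0
  then show ?case using f by simp
next
  case (Suc n)
  define a where "a = int n + 1"
  have a: "1 \<le> a" "a < q" "int (Suc n) = a" "int n = a - 1"
    using Suc.prems by (auto simp: a_def)
  have upto: "[1..a] = [1..a - 1] @ [a]" "[2..a + 1] = [2..a] @ [a + 1]"
    using a upto_rec2[of 1 a] upto_rec2[of 2 "a + 1"] by simp_all
  have h: "fold bk [1..a - 1] f \<in> labelings q"
    and IH: "fold (\<lambda>i. jdt_step P l u v i ^^ l) [2..a] (box_encoding 1 f) =
      box_encoding a (fold bk [1..a - 1] f)"
    using Suc a by auto
  show ?case
    unfolding a(3) upto
    using jdt_step_pow_box_encoding[OF h \<open>0 < l\<close>, of a] bk_labelings[OF h a(1,2)] by (simp add: IH)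
qed

section \<open>Comparison of the two promotion operators\<close>

lemma fold_bender_knuth:
  assumes "f \<in> labelings q" and "set xs \<subseteq> {1..<q}"
  shows "fold (bender_knuth P l u v (Rq P l u v q)) xs f = fold bk xs f"
  using assms by (induction xs arbitrary: f) (auto simp: bender_knuth_eq_bk bk_labelings)

lemma fold_bender_knuth_trivial:
  assumes "f \<in> labelings q" and "set xs \<inter> {1..<q} = {}"
  shows "fold (bender_knuth P l u v (Rq P l u v q)) xs f = f"
  using assms by (induction xs) (auto simp: bender_knuth_trivial)

lemma Pro_eq:
  assumes f: "f \<in> labelings q" and h: "fold bk [1..q - 1] f \<in> labelings q" and "0 < q"
  shows "Pro P l u v (Rq P l u v q) f = fold bk [1..q - 1] f"
proof -
  let ?bk = "bender_knuth P l u v (Rq P l u v q)"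
  have *: "fold ?bk [a..b] f = fold bk [1..q - 1] f" if "a \<le> - q" "q \<le> b" for a b
  proof -
    have "[a..b] = [a..0] @ [1..q - 1] @ [q..b]"
      using that \<open>0 < q\<close> upto_split2[of a 0 b] upto_split2[of 1 "q - 1" b] by (cases "q = 1") auto
    moreover have "fold ?bk [a..0] f = f"
      using f by (intro fold_bender_knuth_trivial) auto
    moreover have "fold ?bk [1..q - 1] f = fold bk [1..q - 1] f"
      using f by (intro fold_bender_knuth) auto
    moreover have "fold ?bk [q..b] (fold bk [1..q - 1] f) = fold bk [1..q - 1] f"
      using h by (intro fold_bender_knuth_trivial) auto
    ultimately show ?thesis
      by simp
  qed
  show ?thesis
    unfolding Pro_def
  proof (rule the_equality)
    show "\<exists>N. \<forall>a b. a \<le> - N \<longrightarrow> N \<le> b \<longrightarrow> fold ?bk [a..b] f = fold bk [1..q - 1] f"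
      using * by blast
  next
    fix g
    assume "\<exists>N. \<forall>a b. a \<le> - N \<longrightarrow> N \<le> b \<longrightarrow> fold ?bk [a..b] f = g"
    then obtain N where "\<And>a b. a \<le> - N \<Longrightarrow> N \<le> b \<Longrightarrow> fold ?bk [a..b] f = g"
      by blast
    \<comment> \<open>A range symmetric about 0 and long enough for both stabilization bounds
      identifies the two limits.\<close>
    from this[of "- max N q" "max N q"] *[of "- max N q" "max N q"]
    show "g = fold bk [1..q - 1] f"
      by simp
  qed
qed

lemma JdtPro_eq:
  assumes f: "f \<in> labelings q" and "0 < l" and "0 < q"
  shows "JdtPro P l u v q f = fold bk [1..q - 1] f"
    and "fold bk [1..q - 1] f \<in> labelings q"
proof -
  let ?h = "fold bk [1..q - 1] f"
  have n: "int (nat (q - 1)) = q - 1"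
    using \<open>0 < q\<close> by simp
  \<comment> \<open>No label is below 1, so nothing is shifted yet.\<close>
  have initial: "jdt_replace P l u v (Some 1) None (\<lambda>z. Some (f z)) = box_encoding 1 f"
    using labelings_range[OF f] unfolding jdt_replace_def box_encoding_def
    by (intro restrict_ext) force
  have h: "?h \<in> labelings q"
    and fold: "fold (\<lambda>i. jdt_step P l u v i ^^ l) [2..q] (box_encoding 1 f) = box_encoding q ?h"
    using fold_jdt_step[OF f \<open>0 < l\<close>, of "nat (q - 1)"] unfolding n by auto
  \<comment> \<open>At threshold \<open>q\<close> every non-box carries its label in
    \<open>?h\<close> plus 1; boxes, where \<open>?h\<close> is \<open>q\<close>, become
    \<open>q + 1\<close>. Subtracting 1 recovers \<open>?h\<close> everywhere.\<close>
  have "JdtPro P l u v q f = restrict ?h D"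
    unfolding JdtPro_def jdt_def initial fold using labelings_range[OF h]
    by (intro restrict_ext) (force simp: jdt_replace_def box_encoding_def)
  then show "JdtPro P l u v q f = ?h"
    using extensional_restrict[OF labelings_extensional[OF h]] by simp
  show "?h \<in> labelings q"
    by (rule h)
qed

end

theorem theorem3p10:
  fixes P :: "'a::order set" and l :: nat and q :: int and u v :: "'a \<Rightarrow> nat"
    and f :: "'a \<times> nat \<Rightarrow> int"
  assumes "finite P" and "0 < l" and "0 < q"
    and "\<And>p. p \<in> P \<Longrightarrow> u p \<in> {0..l} \<and> v p \<in> {0..l} \<and> u p + v p \<le> l"
    and "\<And>p1 p2. p1 \<in> P \<Longrightarrow> p2 \<in> P \<Longrightarrow> p1 \<le> p2 \<Longrightarrow> v p1 \<le> v p2 \<and> u p1 \<ge> u p2"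
    and "P_strict P l u v (\<lambda>_. {1..q}) \<noteq> {}"
    and "f \<in> P_strict P l u v (Rq P l u v q)"
  shows "JdtPro P l u v q f = Pro P l u v (Rq P l u v q) f"
proof -
  interpret poset_strip P l u v
    using assms(5) by unfold_locales auto
  have f: "f \<in> labelings q"
    using assms(7) by (simp add: P_strict_Rq)
  show ?thesis
    using JdtPro_eq[OF f assms(2,3)] Pro_eq[OF f _ assms(3)] by simp
qed

end
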